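(* Let $T:X\to X$ be a measurable transformation, $\mathcal{Z}$ a finite measurable partition of $X$, and $x\in X$. If $\overline{R}(x,T,\mathcal{Z})<1$, then $AIC(x,n)\approx\text{constant}$. More specifically, $$\limsup_{n\to\infty}\frac{AIC(x,n)}{\log^2 n}\le\frac{-1}{\log\overline{R}(x,T,\mathcal{Z})} .$$
   Context: $Z_n(x)$ is the element of $\bigvee_{k=0}^{n-1}T^{-k}\mathcal{Z}$ containing $x$. For $A\subset X$, $\tau(A)=\min\{k>0:T^kA\cap A\ne\emptyset\}$. The upper $\mathcal{Z}$-recurrence rate is $\overline{R}(x,T,\mathcal{Z})=\limsup_{n\to\infty}\tau(Z_n(x))/n$. If $\overline{R}=0$ the right-hand side is read as $0$. Here $\log=\log_2$, and $\log^2 n=(\log n)^2$. Algorithmic information content: let $A_1,A_2,\dots$ be a computable enumeration of the Turing machines and $e_n$ the $n$-th binary string in lexicographical order $0,1,00,01,\dots$. Fix a universal Turing machine $U$, i.e. one with $U(\hat e_n p)=A_n(p)$ for all $n$ and all finite binary strings $p$, where for a word $q$ of length $m$, $\hat q=q(0)q(0)q(1)q(1)\cdots q(m-1)q(m-1)01$. For a finite string $s$ over a finite alphabet, $AIC_U(s)=\min\{\ell(p):U(p)=s\}$ over finite binary strings $p$, with $\ell(p)$ the length of $p$ (and $\infty$ if there is no such $p$). Writing $\mathcal{Z}=\{I_0,\dots,I_{m}\}$ and $\omega_j$ for the index with $T^jx\in I_{\omega_j}$, put $AIC(x,n)=AIC_U(\omega_0\cdots\omega_{n-1})$. For sequences,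 $a_n\approx b_n$ means that for every $\epsilon>0$, $a_n/b_n=o(n^\epsilon)$ and $b_n/a_n=o(n^\epsilon)$ as $n\to\infty$. *)

theory Defs
  imports "HOL-Analysis.Analysis" "HOL-Library.Nat_Bijection"
begin

text \<open>
  Deterministic multi-tape machines given by a finite transition table. Tapes are two-way
  infinite; tape symbols and states are natural numbers, of which a given table mentions only
  finitely many. Symbol 0 is the blank, and symbol \<open>a + 1\<close> is the letter \<open>a\<close>. The start state is 0,
  and a machine halts as soon as no table entry applies.
\<close>

datatype dir = Lft | Stay | Rgt

type_synonym instr = "(nat \<times> nat list) \<times> (nat \<times> (nat \<times> dir) list)"

text \<open>An entry \<open>((q, rs), (q', as))\<close> reads: in state \<open>q\<close>, scanning the symbols \<open>rs\<close> on the tapes,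
  go to state \<open>q'\<close> and, on each tape, write a symbol and move the head according to \<open>as\<close>.\<close>

record tm =
  num_tapes :: nat
  table :: "instr list"

definition is_tm :: "tm \<Rightarrow> bool" where
  "is_tm M \<longleftrightarrow> num_tapes M \<ge> 1 \<and> distinct (map fst (table M)) \<and>
     (\<forall>((q, rs), (q', as)) \<in> set (table M). length rs = num_tapes M \<and> length as = num_tapes M)"

type_synonym tape = "(int \<Rightarrow> nat) \<times> int"
type_synonym config = "nat \<times> tape list"

fun offset :: "dir \<Rightarrow> int" where
  "offset Lft = -1" | "offset Stay = 0" | "offset Rgt = 1"

fun scanned :: "tape \<Rightarrow> nat" where
  "scanned (f, i) = f i"

fun act :: "nat \<times> dir \<Rightarrow> tape \<Rightarrow> tape" where
  "act (a, d) (f, i) = (f(i := a), i + offset d)"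

fun tm_step :: "tm \<Rightarrow> config \<Rightarrow> config option" where
  "tm_step M (q, ts) =
     (case map_of (table M) (q, map scanned ts) of
        None \<Rightarrow> None
      | Some (q', as) \<Rightarrow> Some (q', map2 act as ts))"

definition step_rel :: "tm \<Rightarrow> (config \<times> config) set" where
  "step_rel M = {(c, c'). tm_step M c = Some c'}"

definition input_tape :: "bool list \<Rightarrow> tape" where
  "input_tape p =
     ((\<lambda>i. if 0 \<le> i \<and> i < int (length p) then (if p ! nat i then 2 else 1) else 0), 0)"

definition blank_tape :: tape where
  "blank_tape = ((\<lambda>_. 0), 0)"

definition init_config :: "tm \<Rightarrow> bool list \<Rightarrow> config" where
  "init_config M p = (0, input_tape p # replicate (num_tapes M - 1) blank_tape)"

definition written :: "tape \<Rightarrow> nat list \<Rightarrow> bool" where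
  "written t s \<longleftrightarrow> (\<forall>i < length s. fst t (int i) = s ! i + 1) \<and> fst t (int (length s)) = 0"

text \<open>\<open>M\<close> computes a partial function from binary strings (on the first tape) to strings over the
  output alphabet \<open>{0, \<dots>, K - 1}\<close> (on the last tape, from cell 0 to the first blank). The relation
  says that this function is defined at \<open>p\<close> with value \<open>s\<close>; it is undefined at \<open>p\<close> if \<open>M\<close> does not
  halt or leaves a word which is not over the output alphabet. The working alphabet of \<open>M\<close> is
  not restricted.\<close>

definition tm_computes :: "nat \<Rightarrow> tm \<Rightarrow> bool list \<Rightarrow> nat list \<Rightarrow> bool" where
  "tm_computes K M p s \<longleftrightarrow> set s \<subseteq> {..<K} \<and>
     (\<exists>q ts. (init_config M p, (q, ts)) \<in> (step_rel M)\<^sup>* \<and> tm_step M (q, ts) = None \<and>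
             written (last ts) s)"

text \<open>\<open>bin_string n\<close> is the \<open>n\<close>-th element (\<open>n \<ge> 1\<close>) of the list 0, 1, 00, 01, 10, 11, 000, \<dots>, and
  the empty string for \<open>n = 0\<close>.\<close>

fun bin_string :: "nat \<Rightarrow> bool list" where
  "bin_string 0 = []"
| "bin_string (Suc n) = bin_string (n div 2) @ [odd n]"

definition hat :: "bool list \<Rightarrow> bool list" where
  "hat q = concat (map (\<lambda>b. [b, b]) q) @ [False, True]"

fun dir_code :: "dir \<Rightarrow> nat" where
  "dir_code Lft = 0" | "dir_code Stay = 1" | "dir_code Rgt = 2"

fun instr_code :: "instr \<Rightarrow> nat" where
  "instr_code ((q, rs), (q', as)) =
     list_encode [q, list_encode rs, q',
                  list_encode (map (\<lambda>(a, d). prod_encode (a, dir_code d)) as)]"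

definition tm_code :: "tm \<Rightarrow> nat" where
  "tm_code M = prod_encode (num_tapes M, list_encode (map instr_code (table M)))"

text \<open>Enumerations are indexed from 1. Computability means that a description of the \<open>n\<close>-th machine
  can be computed from \<open>n\<close>, both written as binary strings.\<close>

definition computable_tm_enumeration :: "(nat \<Rightarrow> tm) \<Rightarrow> bool" where
  "computable_tm_enumeration A \<longleftrightarrow>
     A ` {1..} = {M. is_tm M} \<and>
     (\<exists>E. is_tm E \<and>
        (\<forall>n\<ge>1. tm_computes 2 E (bin_string n) (map of_bool (bin_string (tm_code (A n))))))"

text \<open>Equality of the two partial functions: both sides undefined, or both defined and equal.\<close>

definition universal_tm :: "nat \<Rightarrow> (nat \<Rightarrow> tm) \<Rightarrow> tm \<Rightarrow> bool" where
  "universal_tm K A U \<longleftrightarrow> is_tm U \<and>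
     (\<forall>n\<ge>1. \<forall>p s. tm_computes K U (hat (bin_string n) @ p) s \<longleftrightarrow> tm_computes K (A n) p s)"

text \<open>The infimum of the empty set is \<open>\<infinity>\<close> in \<^typ>\<open>enat\<close>.\<close>

definition AIC :: "nat \<Rightarrow> tm \<Rightarrow> nat list \<Rightarrow> enat" where
  "AIC K U s = Inf {enat (length p) | p. tm_computes K U p s}"

definition pullback_partition :: "'a set \<Rightarrow> ('a \<Rightarrow> 'a) \<Rightarrow> nat \<Rightarrow> 'a set set \<Rightarrow> 'a set set" where
  "pullback_partition X T k Z = (\<lambda>A. (T ^^ k) -` A \<inter> X) ` Z - {{}}"

definition iterated_join :: "'a set \<Rightarrow> ('a \<Rightarrow> 'a) \<Rightarrow> 'a set set \<Rightarrow> nat \<Rightarrow> 'a set set" where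
  "iterated_join X T Z n = common_refinement ((\<lambda>k. pullback_partition X T k Z) ` {..<n})"

text \<open>Meaningful for \<open>n \<ge> 1\<close>.\<close>

definition cylinder :: "'a set \<Rightarrow> ('a \<Rightarrow> 'a) \<Rightarrow> 'a set set \<Rightarrow> nat \<Rightarrow> 'a \<Rightarrow> 'a set" where
  "cylinder X T Z n x = (THE C. C \<in> iterated_join X T Z n \<and> x \<in> C)"

definition return_time :: "('a \<Rightarrow> 'a) \<Rightarrow> 'a set \<Rightarrow> enat" where
  "return_time T A = Inf {enat k | k. k > 0 \<and> (T ^^ k) ` A \<inter> A \<noteq> {}}"

definition upper_recurrence_rate :: "'a set \<Rightarrow> ('a \<Rightarrow> 'a) \<Rightarrow> 'a set set \<Rightarrow> 'a \<Rightarrow> ereal" where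
  "upper_recurrence_rate X T Z x =
     limsup (\<lambda>n. ereal_of_enat (return_time T (cylinder X T Z n x)) / ereal (real n))"

definition orbit_symbol :: "('a \<Rightarrow> 'a) \<Rightarrow> nat \<Rightarrow> (nat \<Rightarrow> 'a set) \<Rightarrow> 'a \<Rightarrow> nat \<Rightarrow> nat" where
  "orbit_symbol T m I x j = (THE i. i \<le> m \<and> (T ^^ j) x \<in> I i)"

text \<open>Orbit words are words over the alphabet \<open>{0, \<dots>, m}\<close>, which has \<open>m + 1\<close> letters.\<close>

definition orbit_AIC :: "tm \<Rightarrow> ('a \<Rightarrow> 'a) \<Rightarrow> nat \<Rightarrow> (nat \<Rightarrow> 'a set) \<Rightarrow> 'a \<Rightarrow> nat \<Rightarrow> enat" where
  "orbit_AIC U T m I x n = AIC (m + 1) U (map (orbit_symbol T m I x) [0..<n])"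

definition subpoly :: "(nat \<Rightarrow> ereal) \<Rightarrow> bool" where
  "subpoly c \<longleftrightarrow> (\<forall>\<epsilon>>0. (\<lambda>n. c n / ereal (real n powr \<epsilon>)) \<longlonglongrightarrow> 0)"

definition subpoly_equiv :: "(nat \<Rightarrow> ereal) \<Rightarrow> (nat \<Rightarrow> ereal) \<Rightarrow> bool" where
  "subpoly_equiv a b \<longleftrightarrow> subpoly (\<lambda>n. a n / b n) \<and> subpoly (\<lambda>n. b n / a n)"

text \<open>Used for \<open>0 \<le> r < 1\<close>; the value at 0 is a convention, the limit as \<open>r\<close> tends to 0.\<close>

definition recurrence_bound :: "ereal \<Rightarrow> ereal" where
  "recurrence_bound r = (if r = 0 then 0 else ereal (- 1 / log 2 (real_of_ereal r)))"

end

theory Submission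
  imports Defs "HOL-Real_Asymp.Real_Asymp"
begin

text \<open>
  If the cylinder of length \<open>n\<close> around \<open>x\<close> returns to itself after \<open>k\<close> steps, then the orbit word
  of length \<open>n\<close> has period \<open>k\<close>, so it is determined by its prefix of length \<open>k\<close> and by \<open>n - k\<close>. When
  \<open>k \<le> r n\<close> for all large \<open>n\<close>, with \<open>r < 1\<close>, iterating this reduces the word to one of boundedly many
  short prefixes in about \<open>log n / log (1/r)\<close> rounds. Writing each binary digit of \<open>n - k\<close> with two bits
  costs about \<open>2 (log n - i log (1/r))\<close> bits in round \<open>i\<close>, which adds up to \<open>log\<^sup>2 n / log (1/r)\<close>: even
  this wasteful code gives the right constant. Each short prefix is hardwired into an explicit
  three-tape machine that decodes the rounds from a program; the universal machine simulates these
  finitely many machines at a bounded cost. Finally let \<open>r\<close> tend to the recurrence rate.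
\<close>

section \<open>Tapes as zippers\<close>

text \<open>\<open>i\<close> is the absolute head position, \<open>l\<close> the reversed content left of the head, and \<open>r\<close> the
  content from the head on.\<close>

definition zipper :: "int \<Rightarrow> nat list \<Rightarrow> nat list \<Rightarrow> tape" where
  "zipper i l r =
     ((\<lambda>j. if j < i then (if nat (i - 1 - j) < length l then l ! nat (i - 1 - j) else 0)
           else (if nat (j - i) < length r then r ! nat (j - i) else 0)), i)"

lemma scanned_zipper [simp]: "scanned (zipper i l []) = 0" "scanned (zipper i l (a # r)) = a"
  by (auto simp: zipper_def)

lemma act_Rgt_zipper [simp]: "act (b, Rgt) (zipper i l r) = zipper (i + 1) (b # l) (tl r)"
proof -
  have "nat (i - j) = Suc (nat (i - 1 - j))" if "j < i" for j :: int
    using that by auto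
  moreover have "nat (j - i) = Suc (nat (j - (i + 1)))" if "i < j" for j :: int
    using that by auto
  ultimately show ?thesis
    by (cases r) (auto simp: zipper_def fun_eq_iff nth_Cons split: nat.splits)
qed

lemma act_Lft_zipper [simp]: "act (b, Lft) (zipper i (c # l) (a # r)) = zipper (i - 1) l (c # b # r)"
proof -
  have "nat (i - 1 - j) = Suc (nat (i - 2 - j))" if "j < i - 1" for j :: int
    using that by auto
  moreover have "nat (j - (i - 1)) = Suc (Suc (nat (j - i - 1)))" if "i < j" for j :: int
    using that by auto
  moreover have "nat (j - i) = Suc (nat (j - i - 1))" if "i < j" for j :: int
    using that by auto
  moreover have "j < i - 1 \<or> j = i - 1 \<or> j = i \<or> i < j" for j by linarith
  ultimately show ?thesis
    by (auto simp: zipper_def fun_eq_iff)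
qed

lemma zipper_blank: "zipper i l [0] = zipper i l []"
  by (auto simp: zipper_def fun_eq_iff)

text \<open>A head that moves left off the implicit blank after the stored content leaves an
  explicit blank behind, which denotes the same tape. Turning back at the end of a word therefore
  needs no separate treatment.\<close>

lemma act_Lft_zipper_scanned [simp]:
  "act (scanned (zipper i (c # l) r), Lft) (zipper i (c # l) r) = zipper (i - 1) l (c # r)"
proof (cases r)
  case Nil
  have "act (0, Lft) (zipper i (c # l) [0]) = zipper (i - 1) l [c, 0]"
    by simp
  also have "\<dots> = zipper (i - 1) l [c]"
    by (auto simp: zipper_def fun_eq_iff nth_Cons split: nat.splits)
  finally show ?thesis using Nil by (simp add: zipper_blank)
qed simp

lemma act_scanned_Stay [simp]: "act (scanned t, Stay) t = t"
  by (cases t) auto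

text \<open>A transition rule is easier to state as a partial function, while a machine carries a
  list with distinct keys; finiteness of the domain bridges the two.\<close>

lemma partial_function_table:
  assumes "finite (dom d)"
  obtains tb where "distinct (map fst tb)" "map_of tb = d"
proof -
  obtain ks where ks: "set ks = dom d" "distinct ks"
    using finite_distinct_list[OF assms] by blast
  have "map_of (map (\<lambda>k. (k, the (d k))) ks) = d"
    by (auto simp: map_of_map_restrict ks fun_eq_iff restrict_map_def dom_def)
  moreover have "distinct (map fst (map (\<lambda>k. (k, the (d k))) ks))"
    using ks by (simp add: comp_def)
  ultimately show ?thesis using that by blast
qed

section \<open>A machine that extends words periodically\<close>

text \<open>The three tapes are the program, a source copy of the current word, and the output. The states,
  with \<open>k = length w\<close>: below \<open>k\<close>, write the start word \<open>w\<close>; \<open>k\<close> and \<open>k + 1\<close>, decrement the counter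
  stored in place on the program tape, reading a flag (2 if a digit follows) and a digit, least
  significant first; \<open>k + 2\<close>, go back to the start of the counter, which is recognised by the blank
  before it; \<open>k + 3\<close>, copy one letter from source to output; \<open>k + 4\<close>, rewind an exhausted source.
  When the counter underflows, its end flag is blanked out and \<open>k + 5\<close>, \<open>k + 6\<close>, \<open>k + 7\<close> rewind source
  and output and copy the output to the source.\<close>

definition rule :: "nat list \<Rightarrow> nat \<Rightarrow> nat \<Rightarrow> nat \<Rightarrow> nat \<Rightarrow> (nat \<times> (nat \<times> dir) list) option" where
  "rule w q a s b = (let k = length w in
     if q < k then Some (q + 1, [(a, Stay), (w ! q, Rgt), (w ! q, Rgt)])
     else if q = k then
       (if a = 2 then Some (k + 1, [(a, Rgt), (s, Stay), (b, Stay)])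
        else if a = 1 then Some (k + 5, [(0, Rgt), (s, Lft), (b, Stay)])
        else None)
     else if q = k + 1 then
       (if a = 1 then Some (k, [(2, Rgt), (s, Stay), (b, Stay)])
        else Some (k + 2, [(1, Lft), (s, Stay), (b, Stay)]))
     else if q = k + 2 then
       (if a \<noteq> 0 then Some (k + 2, [(a, Lft), (s, Stay), (b, Stay)])
        else Some (k + 3, [(a, Rgt), (s, Stay), (b, Stay)]))
     else if q = k + 3 then
       (if s \<noteq> 0 then Some (k, [(a, Stay), (s, Rgt), (s, Rgt)])
        else Some (k + 4, [(a, Stay), (s, Lft), (b, Stay)]))
     else if q = k + 4 then
       (if s \<noteq> 0 then Some (k + 4, [(a, Stay), (s, Lft), (b, Stay)])
        else Some (k + 3, [(a, Stay), (s, Rgt), (b, Stay)]))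
     else if q = k + 5 then
       (if s \<noteq> 0 then Some (k + 5, [(a, Stay), (s, Lft), (b, Stay)])
        else Some (k + 6, [(a, Stay), (s, Rgt), (b, Lft)]))
     else if q = k + 6 then
       (if b \<noteq> 0 then Some (k + 6, [(a, Stay), (s, Stay), (b, Lft)])
        else Some (k + 7, [(a, Stay), (s, Stay), (b, Rgt)]))
     else if q = k + 7 then
       (if b \<noteq> 0 then Some (k + 7, [(a, Stay), (b, Rgt), (b, Rgt)])
        else Some (k, [(a, Stay), (s, Stay), (b, Stay)]))
     else None)"

text \<open>\<open>rule\<close> itself accepts arbitrary symbols. Cutting the scanned symbols off at
  \<open>B\<close> makes the domain finite, so that it can be listed as a table.\<close>

definition bounded_rule ::
    "nat list \<Rightarrow> nat \<Rightarrow> nat \<times> nat list \<Rightarrow> (nat \<times> (nat \<times> dir) list) option" where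
  "bounded_rule w B = (\<lambda>(q, rs).
     if length rs = 3 \<and> set rs \<subseteq> {..<B} then rule w q (rs ! 0) (rs ! 1) (rs ! 2) else None)"

lemma length_rule: "rule w q a s b = Some (q', as) \<Longrightarrow> length as = 3"
  by (auto simp: rule_def Let_def split: if_splits)

lemma finite_dom_bounded_rule: "finite (dom (bounded_rule w B))"
proof (rule finite_subset)
  show "dom (bounded_rule w B) \<subseteq>
      {..<length w + 8} \<times> {rs. set rs \<subseteq> {..<B} \<and> length rs = 3}"
    by (auto simp: bounded_rule_def rule_def Let_def split: if_splits)
  show "finite ({..<length w + 8} \<times> {rs. set rs \<subseteq> {..<B} \<and> length rs = 3})"
    by (intro finite_cartesian_product finite_lists_length_eq) auto
qed

text \<open>\<open>B\<close> exceeds the bit symbols 1 and 2 and all letters of \<open>w\<close>.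
  Letters start at 1 because 0 is the blank, and a nonempty start word guarantees that there is
  always a letter to copy.\<close>

locale periodic_decoder =
  fixes D :: tm and w :: "nat list" and B :: nat
  assumes D_tm: "is_tm D" and D_tapes: "num_tapes D = 3"
    and D_table: "map_of (table D) = bounded_rule w B"
    and B: "3 \<le> B" and w_symbols: "set w \<subseteq> {1..<B}" and w_nonempty: "w \<noteq> []"

lemma periodic_decoder_exists:
  assumes "3 \<le> B" "set w \<subseteq> {1..<B}" "w \<noteq> []"
  obtains D where "periodic_decoder D w B"
proof -
  obtain tb where tb: "distinct (map fst tb)" "map_of tb = bounded_rule w B"
    using partial_function_table[OF finite_dom_bounded_rule] by blast
  have "is_tm \<lparr>num_tapes = 3, table = tb\<rparr>"
  proof -
    have "length rs = 3 \<and> length as = 3" if "((q, rs), (q', as)) \<in> set tb" for q rs q' as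
    proof -
      have "bounded_rule w B (q, rs) = Some (q', as)"
        using that tb by (metis map_of_is_SomeI)
      then show ?thesis
        by (auto simp: bounded_rule_def length_rule split: if_splits)
    qed
    then show ?thesis using tb(1) by (auto simp: is_tm_def)
  qed
  then show ?thesis
    using assms tb(2) that[of "\<lparr>num_tapes = 3, table = tb\<rparr>"]
    by (simp add: periodic_decoder_def)
qed

section \<open>Counter blocks, word tapes and periodic extension\<close>

fun bits_value :: "bool list \<Rightarrow> nat" where
  "bits_value [] = 0"
| "bits_value (b # bs) = of_bool b + 2 * bits_value bs"

definition bit_symbol :: "bool \<Rightarrow> nat" where
  "bit_symbol b = (if b then 2 else 1)"

text \<open>A self-delimiting code: \<open>True\<close> announces a digit, \<open>False\<close> ends
  the number. Leading zeros are harmless, so the counter can be decremented in place without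
  changing its length.\<close>

definition block :: "bool list \<Rightarrow> bool list" where
  "block bs = concat (map (\<lambda>b. [True, b]) bs) @ [False]"

text \<open>The blank to the left of the word is kept explicitly, since a rewinding head has to step
  onto it in order to stop.\<close>

definition word_tape :: "nat list \<Rightarrow> nat \<Rightarrow> tape" where
  "word_tape u j = zipper (int j) (rev (take j u) @ [0]) (drop j u)"

lemma scanned_word_tape: "scanned (word_tape u j) = (if j < length u then u ! j else 0)"
  by (cases "drop j u") (auto simp: word_tape_def dest: nth_via_drop)

lemma scanned_word_tape_end [simp]: "scanned (word_tape u (length u)) = 0"
  by (simp add: scanned_word_tape)

lemma word_tape_advance:
  assumes "j < length u"
  shows "act (u ! j, Rgt) (word_tape u j) = word_tape u (Suc j)"
  using assms by (simp add: word_tape_def take_Suc_conv_app_nth tl_drop drop_Suc add.commute)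

lemma word_tape_append:
  "act (a, Rgt) (word_tape u (length u)) = word_tape (u @ [a]) (Suc (length u))"
  by (simp add: word_tape_def add.commute)

definition cyclic_extend :: "nat list \<Rightarrow> nat \<Rightarrow> nat list" where
  "cyclic_extend u d = u @ map (\<lambda>t. u ! (t mod length u)) [0..<d]"

lemma length_cyclic_extend [simp]: "length (cyclic_extend u d) = length u + d"
  by (simp add: cyclic_extend_def)

lemma set_cyclic_extend: "u \<noteq> [] \<Longrightarrow> set (cyclic_extend u d) = set u"
  by (auto simp: cyclic_extend_def)

context periodic_decoder
begin

section \<open>Runs of the decoder and rewinding\<close>

definition reaches :: "config \<Rightarrow> config \<Rightarrow> bool"  (infix "\<leadsto>" 50) where
  "c \<leadsto> c' \<longleftrightarrow> (c, c') \<in> (step_rel D)\<^sup>*"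

lemma reaches_refl [simp]: "c \<leadsto> c"
  by (simp add: reaches_def)

lemma reaches_trans [trans]: "c \<leadsto> c' \<Longrightarrow> c' \<leadsto> c'' \<Longrightarrow> c \<leadsto> c''"
  by (simp add: reaches_def)

lemma step:
  assumes "rule w q (scanned t1) (scanned t2) (scanned t3) = Some (q', [a1, a2, a3])"
    and "scanned t1 < B" "scanned t2 < B" "scanned t3 < B"
  shows "(q, [t1, t2, t3]) \<leadsto> (q', [act a1 t1, act a2 t2, act a3 t3])"
  unfolding reaches_def using assms
  by (intro r_into_rtrancl) (auto simp: step_rel_def D_table bounded_rule_def)

text \<open>\<open>P\<close> and \<open>P'\<close> embed the moving tape into the list of all tapes,
  so that one induction serves the program, source and output tapes; they differ because the
  stopping step may also move another head. The run starts just after the left move that enters the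
  rewinding state.\<close>

lemma rewind:
  assumes left: "\<And>t. scanned t \<noteq> 0 \<Longrightarrow> scanned t < B \<Longrightarrow>
        (q, P t) \<leadsto> (q, P (act (scanned t, Lft) t))"
    and stop: "\<And>t. scanned t = 0 \<Longrightarrow> (q, P t) \<leadsto> (q', P' (act (scanned t, Rgt) t))"
    and "set u \<subseteq> {1..<B}"
  shows "(q, P (act (scanned (zipper i (rev u @ 0 # g) r), Lft) (zipper i (rev u @ 0 # g) r)))
          \<leadsto> (q', P' (zipper (i - int (length u)) (0 # g) (u @ r)))"
  using assms(3)
proof (induction u arbitrary: i r rule: rev_induct)
  case Nil
  have "(q, P (zipper (i - 1) g (0 # r))) \<leadsto> (q', P' (zipper i (0 # g) r))"
    using stop[of "zipper (i - 1) g (0 # r)"] by simp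
  then show ?case by simp
next
  case (snoc c u)
  have "(q, P (zipper (i - 1) (rev u @ 0 # g) (c # r))) \<leadsto>
      (q, P (act (scanned (zipper (i - 1) (rev u @ 0 # g) (c # r)), Lft)
        (zipper (i - 1) (rev u @ 0 # g) (c # r))))"
    using snoc.prems by (intro left) auto
  also have "\<dots> \<leadsto> (q', P' (zipper (i - 1 - int (length u)) (0 # g) (u @ c # r)))"
    using snoc.prems by (intro snoc.IH) auto
  finally show ?case
    by (simp del: act.simps add: algebra_simps)
qed


section \<open>Subroutines: loading, counting, copying\<close>

abbreviation K :: nat where "K \<equiv> length w"

abbreviation syms :: "bool list \<Rightarrow> nat list" where
  "syms bs \<equiv> map bit_symbol (block bs)"

lemma scanned_word_tape_bound: "set u \<subseteq> {1..<B} \<Longrightarrow> scanned (word_tape u j) < B"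
  using B by (auto simp: scanned_word_tape subset_iff)

lemma rewind_word_tape:
  assumes "\<And>t. scanned t \<noteq> 0 \<Longrightarrow> scanned t < B \<Longrightarrow>
        (q, P t) \<leadsto> (q, P (act (scanned t, Lft) t))"
    and "\<And>t. scanned t = 0 \<Longrightarrow> (q, P t) \<leadsto> (q', P' (act (scanned t, Rgt) t))"
    and "set u \<subseteq> {1..<B}" "j \<le> length u"
  shows "(q, P (act (scanned (word_tape u j), Lft) (word_tape u j))) \<leadsto> (q', P' (word_tape u 0))"
proof -
  have "set (take j u) \<subseteq> {1..<B}"
    using assms(3) set_take_subset by fastforce
  from rewind[where P = P and P' = P', OF assms(1,2) this, of "int j" "[]" "drop j u"]
  show ?thesis using assms(4) by (simp add: word_tape_def del: act.simps)
qed

lemma load: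
  assumes "scanned tI < B" "n \<le> K"
  shows "(0, [tI, word_tape [] 0, word_tape [] 0]) \<leadsto>
    (n, [tI, word_tape (take n w) n, word_tape (take n w) n])"
  using assms(2)
proof (induction n)
  case (Suc n)
  let ?t = "word_tape (take n w) n"
  have t: "act (w ! n, Rgt) ?t = word_tape (take (Suc n) w) (Suc n)" "scanned ?t = 0"
    using Suc.prems word_tape_append[of "w ! n" "take n w"] scanned_word_tape_end[of "take n w"]
    by (simp_all add: take_Suc_conv_app_nth)
  have "(n, [tI, ?t, ?t]) \<leadsto>
      (Suc n, [act (scanned tI, Stay) tI, act (w ! n, Rgt) ?t, act (w ! n, Rgt) ?t])"
    using Suc.prems assms(1) B t(2) by (intro step) (auto simp: rule_def)
  also have "\<dots> = (Suc n, [tI, word_tape (take (Suc n) w) (Suc n), word_tape (take (Suc n) w) (Suc n)])"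
    by (simp only: t act_scanned_Stay)
  finally show ?case using Suc by (meson Suc_leD reaches_trans)
qed simp

text \<open>Subtraction with borrow: low zeros turn into ones up to the first one, which becomes
  zero. The list \<open>a\<close> collects the pairs already passed, and the head finally rewinds
  over them to the blank in front of the counter.\<close>

lemma decrement:
  assumes "0 < bits_value bs" "set a \<subseteq> {1..<B}" "scanned tS < B" "scanned tO < B"
  shows "\<exists>bs'. bits_value bs = Suc (bits_value bs') \<and>
    (K, [zipper i (rev a @ 0 # g) (syms bs @ r), tS, tO]) \<leadsto>
    (K + 3, [zipper (i - int (length a)) (0 # g) (a @ syms bs' @ r), tS, tO])"
  using assms(1,2)
proof (induction bs arbitrary: a i)
  case (Cons b bs)
  let ?l = "rev a @ 0 # g"
  let ?I = "zipper i ?l (2 # bit_symbol b # syms bs @ r)"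
  have syms: "syms (b # bs) = 2 # bit_symbol b # syms bs"
    by (simp add: block_def bit_symbol_def)
  have "(K, [?I, tS, tO]) \<leadsto> (K + 1, [act (2, Rgt) ?I, act (scanned tS, Stay) tS, act (scanned tO, Stay) tO])"
    using B assms(3,4) by (intro step) (auto simp: rule_def)
  also have "\<dots> = (K + 1, [zipper (i + 1) (2 # ?l) (bit_symbol b # syms bs @ r), tS, tO])"
    by (simp del: act.simps)
  finally have first: "(K, [?I, tS, tO]) \<leadsto> \<dots>" .
  let ?J = "zipper (i + 1) (2 # ?l) (bit_symbol b # syms bs @ r)"
  show ?case
  proof (cases b)
    case False
    have "(K + 1, [?J, tS, tO]) \<leadsto> (K, [act (2, Rgt) ?J, act (scanned tS, Stay) tS, act (scanned tO, Stay) tO])"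
      using B assms(3,4) False by (intro step) (auto simp: rule_def bit_symbol_def)
    also have "\<dots> = (K, [zipper (i + 2) (rev (a @ [2, 2]) @ 0 # g) (syms bs @ r), tS, tO])"
      by (simp add: add.commute del: act.simps)
    finally have second: "(K + 1, [?J, tS, tO]) \<leadsto> \<dots>" .
    obtain bs' where bs': "bits_value bs = Suc (bits_value bs')"
      "(K, [zipper (i + 2) (rev (a @ [2, 2]) @ 0 # g) (syms bs @ r), tS, tO]) \<leadsto>
       (K + 3, [zipper (i + 2 - int (length (a @ [2, 2]))) (0 # g) ((a @ [2, 2]) @ syms bs' @ r), tS, tO])"
      using Cons.IH[of "a @ [2, 2]" "i + 2"] Cons.prems False B by auto
    have eq: "(a @ [2, 2]) @ syms bs' @ r = a @ syms (True # bs') @ r"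
      by (simp add: block_def bit_symbol_def)
    have "i + 2 - int (length (a @ [2, 2 :: nat])) = i - int (length a)"
      by simp
    note reaches_trans[OF first reaches_trans[OF second bs'(2)[unfolded eq this]]]
    then show ?thesis
      using False bs'(1) syms by (intro exI[of _ "True # bs'"]) simp
  next
    case True
    \<comment> \<open>The machine overwrites the digit by 1 and moves left. In \<open>?Z\<close> the
      1 is already in place, which gives the move the form that \<open>rewind\<close>
      expects.\<close>
    let ?Z = "zipper (i + 1) (rev (a @ [2]) @ 0 # g) (1 # syms bs @ r)"
    have "(K + 1, [?J, tS, tO]) \<leadsto> (K + 2, [act (1, Lft) ?J, act (scanned tS, Stay) tS, act (scanned tO, Stay) tO])"
      using B assms(3,4) True by (intro step) (auto simp: rule_def bit_symbol_def)
    also have "\<dots> = (K + 2, [act (scanned ?Z, Lft) ?Z, tS, tO])"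
      by (simp del: act.simps)
    also have "\<dots> \<leadsto> (K + 3, [zipper (i + 1 - int (length (a @ [2]))) (0 # g) ((a @ [2]) @ 1 # syms bs @ r), tS, tO])"
    proof (rule rewind[where P = "\<lambda>t. [t, tS, tO]" and P' = "\<lambda>t. [t, tS, tO]"])
      show "(K + 2, [t, tS, tO]) \<leadsto> (K + 2, [act (scanned t, Lft) t, tS, tO])"
        if "scanned t \<noteq> 0" "scanned t < B" for t
        using step[of "K + 2" t tS tO "K + 2" "(scanned t, Lft)" "(scanned tS, Stay)" "(scanned tO, Stay)"]
          that assms(3,4) by (simp add: rule_def)
      show "(K + 2, [t, tS, tO]) \<leadsto> (K + 3, [act (scanned t, Rgt) t, tS, tO])"
        if "scanned t = 0" for t
        using step[of "K + 2" t tS tO "K + 3" "(scanned t, Rgt)" "(scanned tS, Stay)" "(scanned tO, Stay)"]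
          that assms(3,4) B by (simp add: rule_def)
      show "set (a @ [2]) \<subseteq> {1..<B}" using Cons.prems B by auto
    qed
    also have "(a @ [2]) @ 1 # syms bs @ r = a @ syms (False # bs) @ r"
      by (simp add: block_def bit_symbol_def)
    finally show ?thesis
      using reaches_trans[OF first] True syms
      by (intro exI[of _ "False # bs"]) simp
  qed
qed simp

text \<open>At zero the borrow runs through all digits to the end flag. The blank written over that
  flag becomes the left marker of the next counter, and the spoiled digits end up in
  \<open>g'\<close>, beyond the marker.\<close>

lemma skip_zero_block:
  assumes "bits_value bs = 0" "scanned tS < B" "scanned tO < B"
  shows "\<exists>i' g'. (K, [zipper i l (syms bs @ r), tS, tO]) \<leadsto>
    (K + 5, [zipper i' (0 # g') r, act (scanned tS, Lft) tS, tO])"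
  using assms(1)
proof (induction bs arbitrary: i l)
  case Nil
  let ?I = "zipper i l (1 # r)"
  have "(K, [?I, tS, tO]) \<leadsto> (K + 5, [act (0, Rgt) ?I, act (scanned tS, Lft) tS, act (scanned tO, Stay) tO])"
    using B assms by (intro step) (auto simp: rule_def)
  also have "\<dots> = (K + 5, [zipper (i + 1) (0 # l) r, act (scanned tS, Lft) tS, tO])"
    by (simp del: act.simps)
  finally show ?case by (auto simp: block_def bit_symbol_def simp del: act.simps)
next
  case (Cons b bs)
  let ?I = "zipper i l (2 # 1 # syms bs @ r)"
  let ?J = "zipper (i + 1) (2 # l) (1 # syms bs @ r)"
  have syms: "syms (b # bs) = 2 # 1 # syms bs"
    using Cons.prems by (simp add: block_def bit_symbol_def)
  have "(K, [?I, tS, tO]) \<leadsto> (K + 1, [act (2, Rgt) ?I, act (scanned tS, Stay) tS, act (scanned tO, Stay) tO])"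
    using B assms by (intro step) (auto simp: rule_def)
  also have "\<dots> = (K + 1, [?J, tS, tO])"
    by (simp del: act.simps)
  also have "\<dots> \<leadsto> (K, [act (2, Rgt) ?J, act (scanned tS, Stay) tS, act (scanned tO, Stay) tO])"
    using B assms by (intro step) (auto simp: rule_def)
  also have "\<dots> = (K, [zipper (i + 2) (2 # 2 # l) (syms bs @ r), tS, tO])"
    by (simp add: add.commute del: act.simps)
  finally have "(K, [?I, tS, tO]) \<leadsto> \<dots>" .
  moreover obtain i' g' where "(K, [zipper (i + 2) (2 # 2 # l) (syms bs @ r), tS, tO]) \<leadsto>
      (K + 5, [zipper i' (0 # g') r, act (scanned tS, Lft) tS, tO])"
    using Cons.IH[of "i + 2" "2 # 2 # l"] Cons.prems by auto
  ultimately have "(K, [?I, tS, tO]) \<leadsto> (K + 5, [zipper i' (0 # g') r, act (scanned tS, Lft) tS, tO])"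
    by (rule reaches_trans)
  then show ?case
    unfolding syms append_Cons by blast
qed

text \<open>The source wraps around lazily, only when a letter is wanted, so its head may stand at
  \<open>length u\<close>; \<open>k\<close> is the position from which the letter is then
  taken.\<close>

lemma emit:
  assumes "scanned tI < B" "set u \<subseteq> {1..<B}" "u \<noteq> []" "j \<le> length u"
    and "k = (if j = length u then 0 else j)"
  shows "(K + 3, [tI, word_tape u j, word_tape v (length v)]) \<leadsto>
    (K, [tI, word_tape u (Suc k), word_tape (v @ [u ! k]) (Suc (length v))])"
proof -
  let ?O = "word_tape v (length v)"
  have O: "scanned ?O < B" using B by simp
  have "(K + 3, [tI, word_tape u j, ?O]) \<leadsto> (K + 3, [tI, word_tape u k, ?O])"
  proof (cases "j = length u")
    case True
    let ?S = "word_tape u j"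
    have S: "scanned ?S = 0" using True by simp
    have "(K + 3, [tI, ?S, ?O]) \<leadsto> (K + 4, [act (scanned tI, Stay) tI, act (scanned ?S, Lft) ?S, act (scanned ?O, Stay) ?O])"
      using B assms S O by (intro step) (auto simp: rule_def)
    also have "\<dots> = (K + 4, [tI, act (scanned ?S, Lft) ?S, ?O])"
      by (simp only: act_scanned_Stay)
    also have "\<dots> \<leadsto> (K + 3, [tI, word_tape u 0, ?O])"
    proof (rule rewind_word_tape[where P = "\<lambda>t. [tI, t, ?O]" and P' = "\<lambda>t. [tI, t, ?O]"])
      show "(K + 4, [tI, t, ?O]) \<leadsto> (K + 4, [tI, act (scanned t, Lft) t, ?O])"
        if "scanned t \<noteq> 0" "scanned t < B" for t
        using step[of "K + 4" tI t ?O "K + 4" "(scanned tI, Stay)" "(scanned t, Lft)" "(scanned ?O, Stay)"]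
          that assms O unfolding act_scanned_Stay by (simp add: rule_def)
      show "(K + 4, [tI, t, ?O]) \<leadsto> (K + 3, [tI, act (scanned t, Rgt) t, ?O])"
        if "scanned t = 0" for t
        using step[of "K + 4" tI t ?O "K + 3" "(scanned tI, Stay)" "(scanned t, Rgt)" "(scanned ?O, Stay)"]
          that assms O unfolding act_scanned_Stay by (simp add: rule_def)
    qed (use assms in auto)
    finally show ?thesis using True assms by simp
  qed (use assms in simp)
  also have k: "k < length u" using assms by auto
  then have uk: "scanned (word_tape u k) = u ! k" "u ! k \<in> {1..<B}"
    using assms(2) nth_mem[OF k] by (simp add: scanned_word_tape, blast)
  have "(K + 3, [tI, word_tape u k, ?O]) \<leadsto>
      (K, [act (scanned tI, Stay) tI, act (u ! k, Rgt) (word_tape u k), act (u ! k, Rgt) ?O])"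
    using B assms(1) uk by (intro step) (auto simp: rule_def)
  also have "\<dots> = (K, [tI, word_tape u (Suc k), word_tape (v @ [u ! k]) (Suc (length v))])"
    by (simp only: act_scanned_Stay word_tape_advance[OF k] word_tape_append)
  finally show ?thesis .
qed

text \<open>The old source \<open>u\<close> is a prefix of the output, so writing the output over it
  leaves no stale letters: once \<open>u\<close> is exhausted, the source cells are blank.\<close>

lemma copy:
  assumes "scanned tI < B" "set (u @ x) \<subseteq> {1..<B}"
  shows "(K + 7, [tI, zipper i l u, zipper i l (u @ x)]) \<leadsto>
    (K, [tI, zipper (i + int (length (u @ x))) (rev (u @ x) @ l) [],
             zipper (i + int (length (u @ x))) (rev (u @ x) @ l) []])"
proof -
  \<comment> \<open>The induction is on the output word, with the source only known to be a prefix
    of it; this survives dropping the first letter of both, even when the source is already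
    empty.\<close>
  have "(K + 7, [tI, zipper i l u, zipper i l v]) \<leadsto>
      (K, [tI, zipper (i + int (length v)) (rev v @ l) [], zipper (i + int (length v)) (rev v @ l) []])"
    if "set v \<subseteq> {1..<B}" "\<exists>x. v = u @ x" for u v
    using that
  proof (induction v arbitrary: i l u)
    case Nil
    then have "u = []" by simp
    let ?t = "zipper i l []"
    have "(K + 7, [tI, ?t, ?t]) \<leadsto> (K, [act (scanned tI, Stay) tI, act (scanned ?t, Stay) ?t, act (scanned ?t, Stay) ?t])"
      using B assms(1) by (intro step) (auto simp: rule_def)
    then show ?case unfolding act_scanned_Stay using \<open>u = []\<close> by simp
  next
    case (Cons a v)
    let ?S = "zipper i l u" and ?O = "zipper i l (a # v)"
    have "scanned ?S < B" using Cons.prems B by (cases u) auto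
    then have "(K + 7, [tI, ?S, ?O]) \<leadsto> (K + 7, [act (scanned tI, Stay) tI, act (a, Rgt) ?S, act (a, Rgt) ?O])"
      using B assms(1) Cons.prems by (intro step) (auto simp: rule_def)
    also have "\<dots> = (K + 7, [tI, zipper (i + 1) (a # l) (tl u), zipper (i + 1) (a # l) v])"
      by (simp del: act.simps)
    also have "\<dots> \<leadsto> (K, [tI, zipper (i + 1 + int (length v)) (rev v @ a # l) [], zipper (i + 1 + int (length v)) (rev v @ a # l) []])"
    proof (rule Cons.IH)
      show "\<exists>x. v = tl u @ x" using Cons.prems(2) by (cases u) auto
    qed (use Cons.prems in simp)
    finally show ?case by (simp add: algebra_simps)
  qed
  then show ?thesis using assms(2) by blast
qed

text \<open>The word produced in one round is the source of the next, so at the end of a round the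
  two tapes have to agree again.\<close>

lemma synchronize:
  assumes "scanned tI < B" "set (u @ x) \<subseteq> {1..<B}" "j \<le> length u"
  shows "(K + 5, [tI, act (scanned (word_tape u j), Lft) (word_tape u j),
            word_tape (u @ x) (length (u @ x))]) \<leadsto>
    (K, [tI, word_tape (u @ x) (length (u @ x)), word_tape (u @ x) (length (u @ x))])"
proof -
  let ?v = "u @ x"
  let ?O = "word_tape ?v (length ?v)" and ?S = "word_tape u 0"
  let ?L = "act (scanned ?O, Lft) ?O"
  have O: "scanned ?O < B" and S: "scanned ?S < B"
    using scanned_word_tape_bound[of ?v "length ?v"] scanned_word_tape_bound[of u 0] assms(2)
    by simp_all
  have "(K + 5, [tI, act (scanned (word_tape u j), Lft) (word_tape u j), ?O]) \<leadsto> (K + 6, [tI, ?S, ?L])"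
  proof (rule rewind_word_tape[where P = "\<lambda>t. [tI, t, ?O]" and P' = "\<lambda>t. [tI, t, ?L]"])
    show "(K + 5, [tI, t, ?O]) \<leadsto> (K + 5, [tI, act (scanned t, Lft) t, ?O])"
      if "scanned t \<noteq> 0" "scanned t < B" for t
      using step[of "K + 5" tI t ?O "K + 5" "(scanned tI, Stay)" "(scanned t, Lft)" "(scanned ?O, Stay)"]
        that assms O unfolding act_scanned_Stay by (simp add: rule_def)
    show "(K + 5, [tI, t, ?O]) \<leadsto> (K + 6, [tI, act (scanned t, Rgt) t, ?L])"
      if "scanned t = 0" for t
      using step[of "K + 5" tI t ?O "K + 6" "(scanned tI, Stay)" "(scanned t, Rgt)" "(scanned ?O, Lft)"]
        that assms O unfolding act_scanned_Stay by (simp add: rule_def)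
  qed (use assms in auto)
  also have "\<dots> \<leadsto> (K + 7, [tI, ?S, word_tape ?v 0])"
  proof (rule rewind_word_tape[where P = "\<lambda>t. [tI, ?S, t]" and P' = "\<lambda>t. [tI, ?S, t]"])
    show "(K + 6, [tI, ?S, t]) \<leadsto> (K + 6, [tI, ?S, act (scanned t, Lft) t])"
      if "scanned t \<noteq> 0" "scanned t < B" for t
      using step[of "K + 6" tI ?S t "K + 6" "(scanned tI, Stay)" "(scanned ?S, Stay)" "(scanned t, Lft)"]
        that assms S unfolding act_scanned_Stay by (simp add: rule_def)
    show "(K + 6, [tI, ?S, t]) \<leadsto> (K + 7, [tI, ?S, act (scanned t, Rgt) t])"
      if "scanned t = 0" for t
      using step[of "K + 6" tI ?S t "K + 7" "(scanned tI, Stay)" "(scanned ?S, Stay)" "(scanned t, Rgt)"]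
        that assms S unfolding act_scanned_Stay by (simp add: rule_def)
  qed (use assms in auto)
  \<comment> \<open>Both heads now stand on cell 0 with the same blank to their left, so
    \<open>copy\<close> applies with \<open>l = [0]\<close>.\<close>
  also have "\<dots> \<leadsto> (K, [tI, ?O, ?O])"
    using copy[OF assms(1,2), of 0 "[0]"] by (simp add: word_tape_def)
  finally show ?thesis .
qed

text \<open>Here \<open>x\<close> is what the current round has appended so far. The congruence
  modulo \<open>length u\<close> is the loop invariant that keeps the source head in phase with the
  output; the induction is on the value left in the counter.\<close>

lemma execute_block:
  assumes "set u \<subseteq> {1..<B}" "u \<noteq> []" "set r \<subseteq> {..<B}"
    and "j \<le> length u" "j mod length u = length (u @ x) mod length u"
    and "set x \<subseteq> {1..<B}"
  shows "\<exists>i' g'. let v = u @ x @ map (\<lambda>t. u ! (t mod length u)) [length (u @ x)..<length (u @ x) + bits_value bs] in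
    (K, [zipper i (0 # g) (syms bs @ r), word_tape u j, word_tape (u @ x) (length (u @ x))]) \<leadsto>
    (K, [zipper i' (0 # g') r, word_tape v (length v), word_tape v (length v)])"
  using assms(4-)
proof (induction "bits_value bs" arbitrary: bs j x)
  case 0
  let ?O = "word_tape (u @ x) (length (u @ x))"
  have O: "scanned ?O < B"
    unfolding scanned_word_tape_end using B by simp
  have r: "scanned (zipper i' g' r) < B" for i' g'
    using assms(3) B by (cases r) auto
  obtain i' g' where "(K, [zipper i (0 # g) (syms bs @ r), word_tape u j, ?O]) \<leadsto>
      (K + 5, [zipper i' (0 # g') r, act (scanned (word_tape u j), Lft) (word_tape u j), ?O])"
    using skip_zero_block[OF 0(1)[symmetric] scanned_word_tape_bound[OF assms(1)], OF O, where l = "0 # g" and i = i and r = r]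
    by blast
  also have "\<dots> \<leadsto> (K, [zipper i' (0 # g') r, ?O, ?O])"
    using synchronize[OF r, of u x j] 0 assms(1) by simp
  finally show ?case
    unfolding 0(1)[symmetric] Let_def by (intro exI) simp
next
  case (Suc d)
  let ?n = "length (u @ x)"
  let ?I = "\<lambda>bs. zipper i (0 # g) (syms bs @ r)"
  define k where "k = (if j = length u then 0 else j)"
  have k: "k = ?n mod length u" "k < length u"
    using Suc.prems(1,2) assms(2) by (auto simp: k_def)
  have O: "scanned (word_tape (u @ x) ?n) < B"
    unfolding scanned_word_tape_end using B by simp
  have syms_bound: "scanned (?I bs) < B" for bs
    using B by (cases bs) (auto simp: block_def bit_symbol_def)
  obtain bs' where bs': "bits_value bs = Suc (bits_value bs')"
    "(K, [?I bs, word_tape u j, word_tape (u @ x) ?n]) \<leadsto> (K + 3, [?I bs', word_tape u j, word_tape (u @ x) ?n])"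
    using decrement[of bs "[]" "word_tape u j" "word_tape (u @ x) ?n" i g r]
      Suc.hyps(2) scanned_word_tape_bound[OF assms(1)] O by auto
  note bs'(2)
  also have "(K + 3, [?I bs', word_tape u j, word_tape (u @ x) ?n]) \<leadsto>
      (K, [?I bs', word_tape u (Suc k), word_tape (u @ (x @ [u ! k])) (length (u @ (x @ [u ! k])))])"
    using emit[OF syms_bound assms(1,2) Suc.prems(1) k_def, of bs' "u @ x"] by simp
  finally have *: "(K, [?I bs, word_tape u j, word_tape (u @ x) ?n]) \<leadsto> \<dots>" .
  have x': "u @ x @ map (\<lambda>t. u ! (t mod length u)) [?n..<?n + bits_value bs] =
      u @ (x @ [u ! k]) @ map (\<lambda>t. u ! (t mod length u))
        [length (u @ (x @ [u ! k]))..<length (u @ (x @ [u ! k])) + bits_value bs']"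
    using bs'(1) k(1) by (simp add: upt_conv_Cons del: upt_Suc)
  have "Suc k \<le> length u" "Suc k mod length u = length (u @ (x @ [u ! k])) mod length u"
    "set (x @ [u ! k]) \<subseteq> {1..<B}"
    using k assms(1) Suc.prems(3)
    by (auto simp: mod_Suc subset_iff)
  from Suc.hyps(1)[of bs', OF _ this] bs'(1) Suc.hyps(2)
  obtain i' g' where "let v = u @ (x @ [u ! k]) @ map (\<lambda>t. u ! (t mod length u))
        [length (u @ (x @ [u ! k]))..<length (u @ (x @ [u ! k])) + bits_value bs'] in
     (K, [?I bs', word_tape u (Suc k), word_tape (u @ (x @ [u ! k])) (length (u @ (x @ [u ! k])))]) \<leadsto>
     (K, [zipper i' (0 # g') r, word_tape v (length v), word_tape v (length v)])"
    by auto
  then show ?case unfolding x' Let_def using reaches_trans[OF *] by blast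
qed

lemma execute_blocks:
  assumes "set u \<subseteq> {1..<B}" "u \<noteq> []"
  shows "\<exists>i' g'. let v = foldl cyclic_extend u (map bits_value bss) in
    (K, [zipper i (0 # g) (concat (map syms bss)), word_tape u (length u), word_tape u (length u)]) \<leadsto>
    (K, [zipper i' (0 # g') [], word_tape v (length v), word_tape v (length v)])"
  using assms
proof (induction bss arbitrary: u i g)
  case Nil
  have "c \<leadsto> c" for c by simp
  then show ?case by (auto simp: Let_def simp del: reaches_refl)
next
  case (Cons bs bss)
  let ?r = "concat (map syms bss)" and ?u = "cyclic_extend u (bits_value bs)"
  have r: "set ?r \<subseteq> {..<B}"
    using B by (auto simp: bit_symbol_def)
  obtain i' g' where 1: "(K, [zipper i (0 # g) (syms bs @ ?r), word_tape u (length u), word_tape u (length u)]) \<leadsto>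
      (K, [zipper i' (0 # g') ?r, word_tape ?u (length ?u), word_tape ?u (length ?u)])"
  proof -
    \<comment> \<open>Shifting the indices by \<open>length u\<close> keeps their residues, so a
      round appends exactly what \<open>cyclic_extend\<close> does.\<close>
    have "u @ map (\<lambda>t. u ! (t mod length u)) [length u..<length u + bits_value bs] = ?u"
      by (auto simp: cyclic_extend_def intro!: nth_equalityI)
    then show ?thesis
      using execute_block[OF Cons.prems r, of "length u" "[]" bs i g] that
      by (auto simp: Let_def)
  qed
  have "set ?u \<subseteq> {1..<B}" "?u \<noteq> []"
    using Cons.prems set_cyclic_extend[of u] by (auto simp: cyclic_extend_def)
  from Cons.IH[OF this, of i' g'] show ?case
    using reaches_trans[OF 1] by (auto simp: Let_def)
qed

section \<open>Correctness of the decoder\<close>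

lemma init_config_eq:
  "init_config D p = (0, [zipper 0 [0] (map bit_symbol p), word_tape [] 0, word_tape [] 0])"
  by (auto simp: init_config_def D_tapes input_tape_def blank_tape_def word_tape_def zipper_def
      fun_eq_iff bit_symbol_def numeral_2_eq_2)

lemma written_word_tape:
  assumes "map Suc s = v"
  shows "written (word_tape v (length v)) s"
proof -
  have "nat (int (length s) - 1 - int i) = length s - 1 - i" for i
    by linarith
  then show ?thesis
    using assms by (auto simp: written_def word_tape_def zipper_def nth_append rev_nth)
qed

lemma decoder_computes:
  assumes "map Suc s = foldl cyclic_extend w (map bits_value bss)" "set s \<subseteq> {..<N}"
  shows "tm_computes N D (concat (map block bss)) s"
proof -
  let ?v = "foldl cyclic_extend w (map bits_value bss)"
  let ?p = "concat (map block bss)"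
  let ?I = "zipper 0 [0] (map bit_symbol ?p)"
  have "scanned ?I < B"
    using B by (cases ?p) (simp_all add: bit_symbol_def del: concat_eq_Nil_conv)
  then have "init_config D ?p \<leadsto> (K, [?I, word_tape w K, word_tape w K])"
    using load[of ?I K] by (simp add: init_config_eq)
  moreover have "concat (map syms bss) = map bit_symbol ?p"
    by (simp add: map_concat comp_def)
  ultimately obtain i g where "init_config D ?p \<leadsto>
      (K, [zipper i (0 # g) [], word_tape ?v (length ?v), word_tape ?v (length ?v)])"
    using execute_blocks[OF w_symbols w_nonempty, of bss 0 "[]"] reaches_trans
    unfolding Let_def by fastforce
  \<comment> \<open>State \<open>K\<close> has no rule for a blank on the program tape, so an
    exhausted program stops the machine.\<close>
  moreover have "tm_step D (K, [zipper i (0 # g) [], t, t']) = None" for t t'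
    by (auto simp: D_table bounded_rule_def rule_def)
  ultimately show ?thesis
    using written_word_tape[OF assms(1)] assms(2) unfolding tm_computes_def reaches_def
    by (metis last.simps list.distinct(1))
qed

end

lemma periodic_decoder_tm:
  assumes "w \<noteq> []" "set w \<subseteq> {1..N}"
  obtains D where "is_tm D"
    "\<And>bss s. map Suc s = foldl cyclic_extend w (map bits_value bss) \<Longrightarrow> set s \<subseteq> {..<N} \<Longrightarrow>
      tm_computes N D (concat (map block bss)) s"
proof -
  have "set w \<subseteq> {1..<max 3 (N + 1)}"
    by (rule order_trans[OF assms(2)]) auto
  then obtain D where "periodic_decoder D w (max 3 (N + 1))"
    using assms(1) periodic_decoder_exists[of "max 3 (N + 1)" w] by auto
  then show ?thesis
    using that periodic_decoder.D_tm periodic_decoder.decoder_computes by blast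
qed

section \<open>Programs for the universal machine\<close>

text \<open>Runs are deterministic, so the two halting configurations coincide. Letters are written
  as nonzero symbols, so the first blank fixes the length of the output.\<close>

lemma tm_computes_unique:
  assumes "tm_computes N M p s" "tm_computes N M p s'"
  shows "s = s'"
proof -
  obtain q ts q' ts' where
    1: "(init_config M p, (q, ts)) \<in> (step_rel M)\<^sup>*" "tm_step M (q, ts) = None" "written (last ts) s" and
    2: "(init_config M p, (q', ts')) \<in> (step_rel M)\<^sup>*" "tm_step M (q', ts') = None" "written (last ts') s'"
    using assms by (auto simp: tm_computes_def)
  have "single_valued (step_rel M)"
    by (auto simp: single_valued_def step_rel_def)
  then have "((q, ts), (q', ts')) \<in> (step_rel M)\<^sup>* \<or> ((q', ts'), (q, ts)) \<in> (step_rel M)\<^sup>*"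
    using 1(1) 2(1) by (rule single_valued_confluent)
  then have "(q, ts) = (q', ts')"
    using 1(2) 2(2) by (auto simp: step_rel_def elim: converse_rtranclE)
  then have w: "written (last ts) s" "written (last ts) s'"
    using 1(3) 2(3) by auto
  then have "length s = length s'"
    unfolding written_def by (metis Suc_eq_plus1 linorder_neqE_nat nat.distinct(1))
  moreover have "s ! i = s' ! i" if "i < length s" for i
    using w that calculation unfolding written_def by (metis add_right_cancel)
  ultimately show ?thesis by (rule nth_equalityI)
qed

lemma Inf_enat_mem:
  fixes S :: "enat set"
  assumes "S \<noteq> {}"
  shows "Inf S \<in> S"
proof -
  obtain k where "k \<in> S" using assms by blast
  then have "(LEAST k. k \<in> S) \<in> S" by (rule LeastI)
  then show ?thesis using assms by (simp add: Inf_enat_def)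
qed

lemma AIC_le: "tm_computes N U p s \<Longrightarrow> AIC N U s \<le> enat (length p)"
  unfolding AIC_def by (rule Inf_lower) auto

lemma AIC_eq_0D:
  assumes "AIC N U s = 0"
  shows "tm_computes N U [] s"
proof -
  have ne: "{enat (length p) |p. tm_computes N U p s} \<noteq> {}"
    using assms unfolding AIC_def by (force simp: top_enat_def)
  then have "AIC N U s \<in> {enat (length p) |p. tm_computes N U p s}"
    unfolding AIC_def by (rule Inf_enat_mem)
  then show ?thesis using assms by (auto simp: zero_enat_def)
qed

text \<open>The decoder for \<open>w\<close> appears somewhere in the enumeration; prefixing a
  program with its doubled index costs a constant that depends on \<open>w\<close> but not on the
  blocks.\<close>

lemma AIC_le_decoder:
  assumes "computable_tm_enumeration A" "universal_tm N A U" "w \<noteq> []" "set w \<subseteq> {1..N}"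
  shows "\<exists>c. \<forall>bss s. map Suc s = foldl cyclic_extend w (map bits_value bss) \<longrightarrow> set s \<subseteq> {..<N} \<longrightarrow>
    AIC N U s \<le> enat (c + length (concat (map block bss)))"
proof -
  obtain D where D: "is_tm D"
    "\<And>bss s. map Suc s = foldl cyclic_extend w (map bits_value bss) \<Longrightarrow> set s \<subseteq> {..<N} \<Longrightarrow>
      tm_computes N D (concat (map block bss)) s"
    using periodic_decoder_tm[OF assms(3,4)] by blast
  obtain n where n: "n \<ge> 1" "A n = D"
  proof -
    have "D \<in> A ` {1..}"
      using assms(1) D(1) by (simp add: computable_tm_enumeration_def)
    then show ?thesis using that by auto
  qed
  have "AIC N U s \<le> enat (length (hat (bin_string n)) + length (concat (map block bss)))"
    if "map Suc s = foldl cyclic_extend w (map bits_value bss)" "set s \<subseteq> {..<N}" for bss s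
  proof -
    have "tm_computes N U (hat (bin_string n) @ concat (map block bss)) s"
      using D(2)[OF that] assms(2) n by (simp add: universal_tm_def)
    from AIC_le[OF this] show ?thesis by simp
  qed
  then show ?thesis by blast
qed

section \<open>Describing recurrent words\<close>

text \<open>The binary expansion of \<open>d\<close> has at most \<open>log 2 d + 1\<close> digits;
  two bits for each and one end flag give the bound.\<close>

lemma bits_value_surj:
  assumes "1 \<le> d"
  shows "\<exists>bs. bits_value bs = d \<and> real (length (block bs)) \<le> 2 * log 2 (real d) + 3"
  using assms
proof (induction d rule: less_induct)
  case (less d)
  have len: "length (block (b # bs)) = length (block bs) + 2" for b bs
    by (simp add: block_def)
  show ?case
  proof (cases "d = 1")
    case True
    then show ?thesis
      by (intro exI[of _ "[True]"]) (simp add: block_def)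
  next
    case False
    then have d: "1 \<le> d div 2" "d div 2 < d" using less.prems by linarith+
    then obtain bs where bs: "bits_value bs = d div 2"
      "real (length (block bs)) \<le> 2 * log 2 (real (d div 2)) + 3"
      using less.IH by blast
    have "real (d div 2) \<le> real d / 2" by linarith
    then have "log 2 (real (d div 2)) \<le> log 2 (real d / 2)"
      using d by (subst log_le_cancel_iff) auto
    also have "\<dots> = log 2 (real d) - 1"
      using less.prems by (simp add: log_divide)
    finally have "log 2 (real (d div 2)) \<le> log 2 (real d) - 1" .
    moreover have "bits_value (odd d # bs) = d"
      using bs(1) by (simp add: mod2_eq_if[symmetric] of_bool_odd_eq_mod_2 del: of_bool_eq_iff)
    ultimately show ?thesis
      using bs(2) len[of "odd d" bs] by (intro exI[of _ "odd d # bs"]) simp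
  qed
qed

lemma periodic_word_eq_cyclic_extend:
  assumes "1 \<le> k" "k \<le> n" "\<And>i. i + k < n \<Longrightarrow> f (i + k) = f i"
  shows "map f [0..<n] = cyclic_extend (map f [0..<k]) (n - k)"
proof -
  have mod: "f i = f (i mod k)" if "i < n" for i
    using that
  proof (induction i rule: less_induct)
    case (less i)
    show ?case
    proof (cases "i < k")
      case False
      then have "f i = f (i - k)" using assms(3)[of "i - k"] less.prems by simp
      also have "\<dots> = f ((i - k) mod k)" using less.prems assms(1) False by (intro less.IH) simp_all
      also have "(i - k) mod k = i mod k" using False by (intro le_mod_geq[symmetric]) simp
      finally show ?thesis .
    qed simp
  qed
  show ?thesis
  proof (rule nth_equalityI)
    fix i assume "i < length (map f [0..<n])"
    then have i: "i < n" by simp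
    show "map f [0..<n] ! i = cyclic_extend (map f [0..<k]) (n - k) ! i"
    proof (cases "i < k")
      case True
      then show ?thesis using i by (simp add: cyclic_extend_def nth_append)
    next
      case False
      then have "i - k < n - k" using i by linarith
      then have "cyclic_extend (map f [0..<k]) (n - k) ! i = f ((i - k) mod k)"
        using i assms(1) False by (simp add: cyclic_extend_def nth_append)
      also have "(i - k) mod k = i mod k"
        using False by (intro le_mod_geq[symmetric]) simp
      finally have "cyclic_extend (map f [0..<k]) (n - k) ! i = f i"
        by (simp only: mod[OF i, symmetric])
      then show ?thesis using i by simp
    qed
  qed (use assms in simp)
qed

text \<open>Put F(b) = b^2 / lam + (1 + 3 / lam) b with b = log n. One round lowers b by at least
  \<open>lam\<close>, and F(b) - F(b - lam) = 2 b + 3, which is the cost of the block written in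
  that round. The linear coefficient is chosen so that this difference comes out exactly.\<close>

lemma recurrent_word_description:
  fixes f :: "nat \<Rightarrow> nat" and r :: real
  assumes r: "0 < r" "r < 1"
    and rec: "\<And>n. n0 \<le> n \<Longrightarrow> \<exists>k. 1 \<le> k \<and> real k \<le> r * real n \<and> (\<forall>i. i + k < n \<longrightarrow> f (i + k) = f i)"
    and "1 \<le> n" and lam: "lam = - log 2 r"
  shows "\<exists>k bss. 1 \<le> k \<and> k < n0 \<and>
    map f [0..<n] = foldl cyclic_extend (map f [0..<k]) (map bits_value bss) \<and>
    real (length (concat (map block bss))) \<le> (log 2 (real n))\<^sup>2 / lam + (1 + 3 / lam) * log 2 (real n)"
  using \<open>1 \<le> n\<close>
proof (induction n rule: less_induct)
  case (less n)
  have lam0: "0 < lam" using r by (simp add: lam)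
  show ?case
  proof (cases "n < n0")
    case True
    have "0 \<le> log 2 (real n)" using less.prems by simp
    then show ?thesis using True less.prems lam0
      by (intro exI[of _ n] exI[of _ "[]"]) simp
  next
    case False
    then have "n0 \<le> n" by simp
    from rec[OF this] obtain k where k: "1 \<le> k" "real k \<le> r * real n"
      "\<forall>i. i + k < n \<longrightarrow> f (i + k) = f i"
      by (elim exE conjE) (rule that)
    have "r * real n < real n" using r less.prems by simp
    then have "k < n" using k(2) by linarith
    from less.IH[OF this k(1)] obtain k0 bss where IH: "1 \<le> k0" "k0 < n0"
      "map f [0..<k] = foldl cyclic_extend (map f [0..<k0]) (map bits_value bss)"
      "real (length (concat (map block bss))) \<le> (log 2 (real k))\<^sup>2 / lam + (1 + 3 / lam) * log 2 (real k)"
      by (elim exE conjE) (rule that)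
    have "1 \<le> n - k" using \<open>k < n\<close> by simp
    from bits_value_surj[OF this] obtain bs where bs: "bits_value bs = n - k" "real (length (block bs)) \<le> 2 * log 2 (real (n - k)) + 3"
      by (elim exE conjE) (rule that)
    let ?a = "log 2 (real k)" and ?b = "log 2 (real n)"
    have a0: "0 \<le> ?a" using k(1) by simp
    have "?a \<le> log 2 (r * real n)"
      using k(1,2) r \<open>k < n\<close> by (subst log_le_cancel_iff) auto
    also have "\<dots> = ?b - lam"
      using r less.prems by (simp add: log_mult lam)
    finally have ab: "?a \<le> ?b - lam" .
    have nk: "log 2 (real (n - k)) \<le> ?b"
      using \<open>k < n\<close> by (subst log_le_cancel_iff) auto
    have "?a\<^sup>2 \<le> (?b - lam)\<^sup>2"
      by (rule power_mono[OF ab a0])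
    then have "?a\<^sup>2 / lam \<le> (?b - lam)\<^sup>2 / lam"
      using lam0 by (intro divide_right_mono) auto
    \<comment> \<open>the term \<open>- 2 * ?b\<close> pays for the digits of the last block\<close>
    also have "\<dots> = ?b\<^sup>2 / lam - 2 * ?b + lam"
    proof -
      have "(b - l)\<^sup>2 / l = b\<^sup>2 / l - 2 * b + l" if "0 < l" for b l :: real
        using that by (simp add: field_simps power2_eq_square)
      then show ?thesis using lam0 .
    qed
    finally have 1: "?a\<^sup>2 / lam \<le> ?b\<^sup>2 / lam - 2 * ?b + lam" .
    have "(1 + 3 / lam) * ?a \<le> (1 + 3 / lam) * (?b - lam)"
      using ab lam0 by (intro mult_left_mono) simp_all
    also have "\<dots> = (1 + 3 / lam) * ?b - lam - 3"
    proof -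
      have "(1 + 3 / l) * (b - l) = (1 + 3 / l) * b - l - 3" if "0 < l" for b l :: real
        using that by (simp add: field_simps)
      then show ?thesis using lam0 .
    qed
    finally have 2: "(1 + 3 / lam) * ?a \<le> (1 + 3 / lam) * ?b - lam - 3" .
    have "real (length (concat (map block (bss @ [bs])))) \<le> ?b\<^sup>2 / lam + (1 + 3 / lam) * ?b"
    proof -
      have "length (concat (map block (bss @ [bs]))) = length (concat (map block bss)) + length (block bs)"
        by simp
      then show ?thesis using IH(4) bs(2) nk 1 2 by linarith
    qed
    \<comment> \<open>The reduction shortens the word while decoding lengthens it, so the first
      reduction becomes the last block.\<close>
    moreover have "map f [0..<n] = foldl cyclic_extend (map f [0..<k0]) (map bits_value (bss @ [bs]))"
    proof -
      have "map f [0..<n] = cyclic_extend (map f [0..<k]) (n - k)"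
        using k(1,3) \<open>k < n\<close> by (intro periodic_word_eq_cyclic_extend) simp_all
      then show ?thesis
        by (simp only: IH(3) bs(1) map_append list.map foldl_append foldl.simps)
    qed
    ultimately show ?thesis using IH(1,2) by (intro exI conjI)
  qed
qed

lemma recurrent_word_AIC_bound:
  fixes \<sigma> :: "nat \<Rightarrow> nat" and r :: real
  assumes "computable_tm_enumeration A" "universal_tm N A U"
    and r: "0 < r" "r < 1" and \<sigma>: "\<And>i. \<sigma> i < N"
    and rec: "\<And>n. n0 \<le> n \<Longrightarrow> \<exists>k. 1 \<le> k \<and> real k \<le> r * real n \<and> (\<forall>i. i + k < n \<longrightarrow> \<sigma> (i + k) = \<sigma> i)"
  obtains b c where "\<And>n. 1 \<le> n \<Longrightarrow> ereal_of_enat (AIC N U (map \<sigma> [0..<n])) \<le>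
    ereal ((log 2 (real n))\<^sup>2 / (- log 2 r) + b * log 2 (real n) + c)"
proof -
  let ?lam = "- log 2 r"
  \<comment> \<open>Letters are shifted by one because symbol 0 is the blank.\<close>
  let ?w = "\<lambda>k. map (\<lambda>i. Suc (\<sigma> i)) [0..<k]"
  define P where "P k c \<longleftrightarrow> (\<forall>bss s. map Suc s = foldl cyclic_extend (?w k) (map bits_value bss) \<longrightarrow>
      set s \<subseteq> {..<N} \<longrightarrow> AIC N U s \<le> enat (c + length (concat (map block bss))))" for k c
  have "\<exists>c. P k c" if "1 \<le> k" for k
    unfolding P_def using that \<sigma>
    by (intro AIC_le_decoder[OF assms(1,2)]) (auto simp: Suc_le_eq)
  then obtain c where c: "\<And>k. 1 \<le> k \<Longrightarrow> P k (c k)"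
    by metis
  have rec': "\<exists>k. 1 \<le> k \<and> real k \<le> r * real n \<and> (\<forall>i. i + k < n \<longrightarrow> Suc (\<sigma> (i + k)) = Suc (\<sigma> i))"
    if "n0 \<le> n" for n
    using rec[OF that] by simp
  \<comment> \<open>Only prefixes shorter than \<open>n0\<close> occur, so finitely many decoders
    suffice; the sum dominates each of their constants.\<close>
  define C where "C = (\<Sum>k<n0. c k)"
  have "ereal_of_enat (AIC N U (map \<sigma> [0..<n])) \<le>
      ereal ((log 2 (real n))\<^sup>2 / ?lam + (1 + 3 / ?lam) * log 2 (real n) + real C)" if n: "1 \<le> n" for n
  proof -
    have "\<exists>k bss. 1 \<le> k \<and> k < n0 \<and> ?w n = foldl cyclic_extend (?w k) (map bits_value bss) \<and>
        real (length (concat (map block bss))) \<le> (log 2 (real n))\<^sup>2 / ?lam + (1 + 3 / ?lam) * log 2 (real n)"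
      by (rule recurrent_word_description[OF r _ n refl]) (rule rec')
    then obtain k bss where k: "1 \<le> k" "k < n0" "?w n = foldl cyclic_extend (?w k) (map bits_value bss)"
      "real (length (concat (map block bss))) \<le> (log 2 (real n))\<^sup>2 / ?lam + (1 + 3 / ?lam) * log 2 (real n)"
      by (elim exE conjE) (rule that)
    have "map Suc (map \<sigma> [0..<n]) = ?w n" "set (map \<sigma> [0..<n]) \<subseteq> {..<N}"
      using \<sigma> by auto
    then have "AIC N U (map \<sigma> [0..<n]) \<le> enat (c k + length (concat (map block bss)))"
      using c[OF k(1)] k(3) unfolding P_def by simp
    then have "ereal_of_enat (AIC N U (map \<sigma> [0..<n])) \<le> ereal (real (c k + length (concat (map block bss))))"
      by (metis ereal_of_enat_le_iff ereal_of_enat_simps(1))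
    also have "\<dots> \<le> ereal ((log 2 (real n))\<^sup>2 / ?lam + (1 + 3 / ?lam) * log 2 (real n) + real C)"
    proof -
      have "c k \<le> C" unfolding C_def using k(2) by (intro member_le_sum) auto
      then show ?thesis using k(4) by simp
    qed
    finally show ?thesis .
  qed
  then show ?thesis by (rule that)
qed

section \<open>Recurrence rate and periods of orbit words\<close>

lemma orbit_symbol_eq_iff:
  assumes "partition_on X (I ` {..m})" "inj_on I {..m}" "(T ^^ j) y \<in> X"
  shows "orbit_symbol T m I y j = i \<longleftrightarrow> i \<le> m \<and> (T ^^ j) y \<in> I i"
proof -
  have "\<exists>!i. i \<le> m \<and> (T ^^ j) y \<in> I i"
  proof -
    have "i = i'" if "i \<le> m" "(T ^^ j) y \<in> I i" "i' \<le> m" "(T ^^ j) y \<in> I i'" for i i'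
    proof -
      have "I i = I i'"
        using assms(1) that by (auto simp: partition_on_def disjoint_def)
      then show ?thesis using assms(2) that by (auto simp: inj_on_def)
    qed
    moreover have "\<exists>i\<le>m. (T ^^ j) y \<in> I i"
      using assms(1,3) by (auto simp: partition_on_def)
    ultimately show ?thesis by blast
  qed
  from theI'[OF this] this show ?thesis unfolding orbit_symbol_def by blast
qed

lemma funpow_mem: "T \<in> X \<rightarrow> X \<Longrightarrow> y \<in> X \<Longrightarrow> (T ^^ j) y \<in> X"
  by (induction j) (simp_all add: Pi_iff)

lemma partition_on_pullback:
  assumes "partition_on X Z" "T \<in> X \<rightarrow> X"
  shows "partition_on X (pullback_partition X T k Z)"
proof (rule partition_onI)
  have Z: "\<Union>Z = X" "disjoint Z"
    using assms(1) by (auto simp: partition_on_def)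
  have "\<exists>A\<in>Z. (T ^^ k) y \<in> A" if "y \<in> X" for y
    using funpow_mem[OF assms(2) that, of k] unfolding Z(1)[symmetric] Union_iff .
  moreover have "\<Union> (pullback_partition X T k Z) = (\<Union>A\<in>Z. (T ^^ k) -` A \<inter> X)"
    unfolding pullback_partition_def by blast
  ultimately show "\<Union> (pullback_partition X T k Z) = X"
    by auto
  show "disjnt p q" if pq: "p \<in> pullback_partition X T k Z" "q \<in> pullback_partition X T k Z" "p \<noteq> q" for p q
  proof -
    obtain A B where AB: "A \<in> Z" "B \<in> Z" "p = (T ^^ k) -` A \<inter> X" "q = (T ^^ k) -` B \<inter> X"
      using pq unfolding pullback_partition_def by blast
    then have "A \<noteq> B" using pq(3) by blast
    then have "A \<inter> B = {}"
      using AB(1,2) Z(2) unfolding disjoint_def by simp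
    then show ?thesis unfolding AB disjnt_def by blast
  qed
qed (simp add: pullback_partition_def)

lemma cylinder_mem:
  assumes "partition_on X Z" "T \<in> X \<rightarrow> X" "x \<in> X" "1 \<le> n"
  shows "cylinder X T Z n x \<in> iterated_join X T Z n" "x \<in> cylinder X T Z n x"
proof -
  have part: "partition_on X (iterated_join X T Z n)"
    unfolding iterated_join_def
  proof (rule partition_on_common_refinement)
    show "(\<lambda>k. pullback_partition X T k Z) ` {..<n} \<noteq> {}"
      using assms(4) by (simp add: lessThan_empty_iff)
  qed (use partition_on_pullback[OF assms(1,2)] in blast)
  have "\<exists>!C. C \<in> iterated_join X T Z n \<and> x \<in> C"
  proof (rule ex_ex1I)
    show "\<exists>C. C \<in> iterated_join X T Z n \<and> x \<in> C"
      using part assms(3) unfolding partition_on_def by blast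
    show "C = C'" if "C \<in> iterated_join X T Z n \<and> x \<in> C" "C' \<in> iterated_join X T Z n \<and> x \<in> C'" for C C'
      using part that unfolding partition_on_def disjoint_def by blast
  qed
  then have "cylinder X T Z n x \<in> iterated_join X T Z n \<and> x \<in> cylinder X T Z n x"
    unfolding cylinder_def by (rule theI')
  then show "cylinder X T Z n x \<in> iterated_join X T Z n" "x \<in> cylinder X T Z n x"
    by simp_all
qed

text \<open>The join refines every pullback, so the whole cylinder lies in one piece of the pullback
  by \<open>j\<close> steps.\<close>

lemma orbit_symbol_cylinder:
  assumes "partition_on X (I ` {..m})" "inj_on I {..m}" "T \<in> X \<rightarrow> X" "x \<in> X"
    and "y \<in> cylinder X T (I ` {..m}) n x" "j < n"
  shows "y \<in> X" "orbit_symbol T m I y j = orbit_symbol T m I x j"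
proof -
  let ?C = "cylinder X T (I ` {..m}) n x"
  have C: "?C \<in> iterated_join X T (I ` {..m}) n" "x \<in> ?C"
    using cylinder_mem[OF assms(1,3,4)] assms(6) by auto
  obtain R where R: "R \<in> pullback_partition X T j (I ` {..m})" "?C \<subseteq> R"
    using common_refinement_exists[OF C(1)[unfolded iterated_join_def]] assms(6) by blast
  then obtain i where i: "i \<le> m" "R = (T ^^ j) -` I i \<inter> X"
    by (auto simp: pullback_partition_def)
  then have y: "y \<in> X" "(T ^^ j) y \<in> I i" and x: "(T ^^ j) x \<in> I i"
    using R(2) assms(5) C(2) by auto
  show "y \<in> X" by fact
  have "orbit_symbol T m I y j = i" "orbit_symbol T m I x j = i"
    using orbit_symbol_eq_iff[OF assms(1,2)] funpow_mem[OF assms(3)] i x y assms(4) by blast+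
  then show "orbit_symbol T m I y j = orbit_symbol T m I x j" by simp
qed

text \<open>If \<open>y\<close> and \<open>(T ^^ k) y\<close> both lie in the cylinder, the orbit of
  \<open>y\<close> spells the word of \<open>x\<close> from time 0 and again from time
  \<open>k\<close>. Comparing the two readings where they overlap yields the period.\<close>

lemma return_time_period:
  assumes "partition_on X (I ` {..m})" "inj_on I {..m}" "T \<in> X \<rightarrow> X" "x \<in> X" "1 \<le> n"
    and "return_time T (cylinder X T (I ` {..m}) n x) < \<infinity>"
  obtains k where "return_time T (cylinder X T (I ` {..m}) n x) = enat k" "1 \<le> k"
    "\<And>i. i + k < n \<Longrightarrow> orbit_symbol T m I x (i + k) = orbit_symbol T m I x i"
proof -
  let ?C = "cylinder X T (I ` {..m}) n x"
  let ?S = "{enat k |k. k > 0 \<and> (T ^^ k) ` ?C \<inter> ?C \<noteq> {}}"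
  \<comment> \<open>The infimum of the empty set is \<infinity>, so a finite return time is attained
    by some \<open>k\<close>.\<close>
  have "?S \<noteq> {}"
  proof
    assume "?S = {}"
    then have "return_time T ?C = \<infinity>"
      by (simp only: return_time_def Inf_enat_def simp_thms if_True)
    then show False using assms(6) by simp
  qed
  then have "return_time T ?C \<in> ?S"
    unfolding return_time_def by (rule Inf_enat_mem)
  then obtain k y where k: "return_time T ?C = enat k" "k > 0" and y: "y \<in> ?C" "(T ^^ k) y \<in> ?C"
    by auto
  note symbol = orbit_symbol_cylinder[OF assms(1-4)]
  have "orbit_symbol T m I x (i + k) = orbit_symbol T m I x i" if "i + k < n" for i
  proof -
    have "orbit_symbol T m I x (i + k) = orbit_symbol T m I y (i + k)"
      using symbol(2)[OF y(1) that] by simp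
    also have "\<dots> = orbit_symbol T m I ((T ^^ k) y) i"
      by (simp add: orbit_symbol_def funpow_add)
    also have "\<dots> = orbit_symbol T m I x i"
      using symbol(2)[OF y(2), of i] that by simp
    finally show ?thesis .
  qed
  then show ?thesis using that k by auto
qed

lemma orbit_AIC_bound:
  fixes r :: real
  assumes "computable_tm_enumeration A" "universal_tm (m + 1) A U"
    and part: "partition_on X (I ` {..m})" and inj: "inj_on I {..m}" and T: "T \<in> X \<rightarrow> X" and x: "x \<in> X"
    and r: "upper_recurrence_rate X T (I ` {..m}) x < ereal r" "0 < r" "r < 1"
  obtains b c where "\<And>n. 1 \<le> n \<Longrightarrow> ereal_of_enat (orbit_AIC U T m I x n) \<le>
    ereal ((log 2 (real n))\<^sup>2 / (- log 2 r) + b * log 2 (real n) + c)"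
proof -
  let ?rt = "\<lambda>n. return_time T (cylinder X T (I ` {..m}) n x)"
  have "eventually (\<lambda>n. ereal_of_enat (?rt n) / ereal (real n) < ereal r) sequentially"
    using r(1) unfolding upper_recurrence_rate_def by (rule Limsup_lessD)
  then obtain n1 where n1: "\<And>n. n1 \<le> n \<Longrightarrow> ereal_of_enat (?rt n) / ereal (real n) < ereal r"
    by (auto simp: eventually_sequentially)
  have sym: "orbit_symbol T m I x i < m + 1" for i
    using iffD1[OF orbit_symbol_eq_iff[OF part inj funpow_mem[OF T x]] refl]
    by (simp add: less_Suc_eq_le)
  have "\<exists>k. 1 \<le> k \<and> real k \<le> r * real n \<and>
      (\<forall>i. i + k < n \<longrightarrow> orbit_symbol T m I x (i + k) = orbit_symbol T m I x i)"
    \<comment> \<open>Length 0 is excluded: the cylinder is meaningful only from length 1 on, and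
      the quotient would divide by zero.\<close>
    if "max n1 1 \<le> n" for n
  proof -
    have n: "1 \<le> n" "ereal_of_enat (?rt n) / ereal (real n) < ereal r"
      using that n1 by auto
    then have "?rt n < \<infinity>" by (cases "?rt n") auto
    then obtain k where k: "?rt n = enat k" "1 \<le> k"
      "\<And>i. i + k < n \<Longrightarrow> orbit_symbol T m I x (i + k) = orbit_symbol T m I x i"
      using return_time_period[OF part inj T x n(1)] by blast
    have "real k \<le> r * real n"
      using n k(1) by (simp add: field_simps)
    then show ?thesis using k by blast
  qed
  from this that show ?thesis
    unfolding orbit_AIC_def by (rule recurrent_word_AIC_bound[OF assms(1,2) r(2,3) sym])
qed

section \<open>Asymptotics\<close>

lemma upper_recurrence_rate_nonneg: "0 \<le> upper_recurrence_rate X T Z x"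
  unfolding upper_recurrence_rate_def
  by (rule le_Limsup) (simp_all add: ereal_of_enat_nonneg)

text \<open>Only the output of the empty program has content 0; without this bound the reciprocal of the
  content could be infinite infinitely often.\<close>

lemma eventually_orbit_AIC_ge_1: "eventually (\<lambda>n. 1 \<le> ereal_of_enat (orbit_AIC U T m I x n)) sequentially"
proof -
  have "finite {n. orbit_AIC U T m I x n = 0}"
  proof (rule finite_subset)
    show "{n. orbit_AIC U T m I x n = 0} \<subseteq> length ` {s. tm_computes (m + 1) U [] s}"
    proof
      fix n assume "n \<in> {n. orbit_AIC U T m I x n = 0}"
      then have "tm_computes (m + 1) U [] (map (orbit_symbol T m I x) [0..<n])"
        by (simp add: orbit_AIC_def AIC_eq_0D)
      then show "n \<in> length ` {s. tm_computes (m + 1) U [] s}"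
        by (intro image_eqI[where x = "map (orbit_symbol T m I x) [0..<n]"]) auto
    qed
    show "finite (length ` {s. tm_computes (m + 1) U [] s})"
    proof (rule finite_imageI)
      obtain s where "{s. tm_computes (m + 1) U [] s} \<subseteq> {s}"
        using tm_computes_unique by blast
      then show "finite {s. tm_computes (m + 1) U [] s}"
        by (rule finite_subset) simp
    qed
  qed
  then have "eventually (\<lambda>n. orbit_AIC U T m I x n \<noteq> 0) sequentially"
    unfolding cofinite_eq_sequentially[symmetric] eventually_cofinite by simp
  then show ?thesis
  proof eventually_elim
    case (elim n)
    then have "1 \<le> orbit_AIC U T m I x n"
      by (simp add: ileI1 one_eSuc zero_less_iff_neq_zero)
    then have "ereal_of_enat 1 \<le> ereal_of_enat (orbit_AIC U T m I x n)"
      by (simp only: ereal_of_enat_le_iff)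
    then show ?case by (simp add: one_enat_def one_ereal_def)
  qed
qed

text \<open>The upper bound settles \<open>a n\<close>, since a squared logarithm is below every
  positive power of \<open>n\<close>; the lower bound settles the reciprocal, which stays between 0
  and 1.\<close>

lemma subpoly_equiv_constant:
  fixes a :: "nat \<Rightarrow> ereal"
  assumes ge: "eventually (\<lambda>n. 1 \<le> a n) sequentially"
    and le: "eventually (\<lambda>n. a n \<le> ereal ((log 2 (real n))\<^sup>2 / l + b * log 2 (real n) + c)) sequentially"
  shows "subpoly_equiv a (\<lambda>n. ereal 1)"
proof -
  have "(\<lambda>n. a n / ereal (real n powr \<epsilon>)) \<longlonglongrightarrow> 0" if "\<epsilon> > 0" for \<epsilon>
  proof (rule tendsto_sandwich[where f = "\<lambda>_. 0"])
    let ?f = "\<lambda>n. ((log 2 (real n))\<^sup>2 / l + b * log 2 (real n) + c) / (real n powr \<epsilon>)"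
    have "(\<lambda>n. (log 2 (real n))\<^sup>2 / real n powr \<epsilon>) \<longlonglongrightarrow> 0" "(\<lambda>n. log 2 (real n) / real n powr \<epsilon>) \<longlonglongrightarrow> 0"
      "(\<lambda>n. 1 / real n powr \<epsilon>) \<longlonglongrightarrow> 0"
      using that unfolding log_def by real_asymp+
    then have "(\<lambda>n. 1 / l * ((log 2 (real n))\<^sup>2 / real n powr \<epsilon>) + b * (log 2 (real n) / real n powr \<epsilon>) +
        c * (1 / real n powr \<epsilon>)) \<longlonglongrightarrow> 1 / l * 0 + b * 0 + c * 0"
      by (intro tendsto_intros)
    then have "?f \<longlonglongrightarrow> 0"
      by (simp add: add_divide_distrib mult.commute)
    then show "(\<lambda>n. ereal (?f n)) \<longlonglongrightarrow> 0"
      by (simp add: zero_ereal_def)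
    show "eventually (\<lambda>n. a n / ereal (real n powr \<epsilon>) \<le> ereal (?f n)) sequentially"
      using le eventually_gt_at_top[of 0]
    proof eventually_elim
      case (elim n)
      then have "a n / ereal (real n powr \<epsilon>) \<le>
          ereal ((log 2 (real n))\<^sup>2 / l + b * log 2 (real n) + c) / ereal (real n powr \<epsilon>)"
        by (intro ereal_divide_right_mono) auto
      then show ?case using elim by simp
    qed
    show "eventually (\<lambda>n. 0 \<le> a n / ereal (real n powr \<epsilon>)) sequentially"
      using ge eventually_gt_at_top[of 0]
    proof eventually_elim
      case (elim n)
      then have "0 \<le> a n" by (cases "a n") (auto simp: one_ereal_def)
      then show ?case using elim by (intro zero_le_divide_ereal) auto
    qed
  qed simp
  moreover have "(\<lambda>n. 1 / a n / ereal (real n powr \<epsilon>)) \<longlonglongrightarrow> 0" if "\<epsilon> > 0" for \<epsilon>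
  proof (rule tendsto_sandwich[where f = "\<lambda>_. 0"])
    have "(\<lambda>n. 1 / real n powr \<epsilon>) \<longlonglongrightarrow> 0"
      using that by real_asymp
    then show "(\<lambda>n. ereal (1 / real n powr \<epsilon>)) \<longlonglongrightarrow> 0"
      by (simp add: zero_ereal_def)
    have "eventually (\<lambda>n. 0 \<le> 1 / a n \<and> 1 / a n \<le> 1) sequentially"
      using ge
    proof eventually_elim
      case (elim n)
      then show ?case by (cases "a n") (auto simp: one_ereal_def)
    qed
    then have "eventually (\<lambda>n. 0 \<le> 1 / a n / ereal (real n powr \<epsilon>) \<and>
        1 / a n / ereal (real n powr \<epsilon>) \<le> ereal (1 / real n powr \<epsilon>)) sequentially"
      using eventually_gt_at_top[of 0]
    proof eventually_elim
      case (elim n)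
      then have "1 / a n / ereal (real n powr \<epsilon>) \<le> 1 / ereal (real n powr \<epsilon>)"
        by (intro ereal_divide_right_mono) auto
      then show ?case using elim by (auto intro!: zero_le_divide_ereal simp: one_ereal_def)
    qed
    then show "eventually (\<lambda>n. 1 / a n / ereal (real n powr \<epsilon>) \<le> ereal (1 / real n powr \<epsilon>)) sequentially"
      "eventually (\<lambda>n. 0 \<le> 1 / a n / ereal (real n powr \<epsilon>)) sequentially"
      by (auto elim: eventually_mono)
  qed simp
  ultimately show ?thesis
    unfolding subpoly_equiv_def subpoly_def one_ereal_def[symmetric] by simp
qed

text \<open>After division by the squared logarithm, the linear and constant terms vanish in the
  limit.\<close>

lemma limsup_log_squared_bound:
  fixes a :: "nat \<Rightarrow> ereal"
  assumes le: "eventually (\<lambda>n. a n \<le> ereal ((log 2 (real n))\<^sup>2 / l + b * log 2 (real n) + c)) sequentially"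
  shows "limsup (\<lambda>n. a n / ereal ((log 2 (real n))\<^sup>2)) \<le> ereal (1 / l)"
proof -
  let ?f = "\<lambda>n. ((log 2 (real n))\<^sup>2 / l + b * log 2 (real n) + c) / (log 2 (real n))\<^sup>2"
  have "(\<lambda>n. b / log 2 (real n) + c / (log 2 (real n))\<^sup>2) \<longlonglongrightarrow> 0"
    unfolding log_def by real_asymp
  then have "(\<lambda>n. 1 / l + (b / log 2 (real n) + c / (log 2 (real n))\<^sup>2)) \<longlonglongrightarrow> 1 / l + 0"
    by (intro tendsto_add tendsto_const)
  moreover have "eventually (\<lambda>n. 1 / l + (b / log 2 (real n) + c / (log 2 (real n))\<^sup>2) = ?f n) sequentially"
    using eventually_gt_at_top[of 1]
  proof eventually_elim
    case (elim n)
    then have "0 < log 2 (real n)" by simp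
    then have "log 2 (real n) \<noteq> 0" by linarith
    then show ?case by (simp add: add_divide_distrib power2_eq_square)
  qed
  ultimately have "?f \<longlonglongrightarrow> 1 / l"
    by (simp add: tendsto_cong)
  then have "limsup (\<lambda>n. ereal (?f n)) = ereal (1 / l)"
    by (intro lim_imp_Limsup) auto
  moreover have "limsup (\<lambda>n. a n / ereal ((log 2 (real n))\<^sup>2)) \<le> limsup (\<lambda>n. ereal (?f n))"
  proof (rule Limsup_mono)
    show "eventually (\<lambda>n. a n / ereal ((log 2 (real n))\<^sup>2) \<le> ereal (?f n)) sequentially"
      using le eventually_gt_at_top[of 1]
    proof eventually_elim
      case (elim n)
      then have "0 < log 2 (real n)" by simp
      then have "log 2 (real n) \<noteq> 0" by linarith
      from elim have "a n / ereal ((log 2 (real n))\<^sup>2) \<le>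
          ereal ((log 2 (real n))\<^sup>2 / l + b * log 2 (real n) + c) / ereal ((log 2 (real n))\<^sup>2)"
        using \<open>log 2 (real n) \<noteq> 0\<close> by (intro ereal_divide_right_mono) auto
      then show ?case using \<open>log 2 (real n) \<noteq> 0\<close> by simp
    qed
  qed
  ultimately show ?thesis by simp
qed

text \<open>The content is bounded only for rates strictly above \<open>R\<close>, so the final
  estimate is a limit from the right. At \<open>R = 0\<close> the convention for
  \<open>recurrence_bound\<close> agrees with that limit.\<close>

lemma recurrence_bound_tendsto:
  assumes "0 \<le> R" "R < 1"
  shows "((\<lambda>r. ereal (1 / (- log 2 r))) \<longlongrightarrow> recurrence_bound (ereal R)) (at_right R)"
proof (cases "R = 0")
  case True
  have "((\<lambda>r. 1 / (- log 2 r)) \<longlongrightarrow> 0) (at_right 0)"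
    unfolding log_def by real_asymp
  then show ?thesis
    using True by (simp add: recurrence_bound_def zero_ereal_def)
next
  case False
  then have "log 2 R < 0"
    using assms by simp
  then have "- log 2 R \<noteq> 0" by linarith
  then have "((\<lambda>r. 1 / (- log 2 r)) \<longlongrightarrow> 1 / (- log 2 R)) (at_right R)"
    using assms False by (intro tendsto_intros) auto
  then show ?thesis
    using False assms by (simp add: recurrence_bound_def zero_ereal_def)
qed

theorem theorem6:
  fixes M :: "'a measure" and T :: "'a \<Rightarrow> 'a" and m :: nat and I :: "nat \<Rightarrow> 'a set" and x :: 'a
    and A :: "nat \<Rightarrow> tm" and U :: tm
  assumes "computable_tm_enumeration A"
    and "universal_tm (m + 1) A U"
    and "T \<in> measurable M M"
    and "partition_on (space M) (I ` {..m})"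
    and "inj_on I {..m}"
    and "I ` {..m} \<subseteq> sets M"
    and "x \<in> space M"
    and "upper_recurrence_rate (space M) T (I ` {..m}) x < 1"
  shows "(\<exists>c>0. subpoly_equiv (\<lambda>n. ereal_of_enat (orbit_AIC U T m I x n)) (\<lambda>n. ereal c)) \<and>
    limsup (\<lambda>n. ereal_of_enat (orbit_AIC U T m I x n) / ereal ((log 2 (real n))\<^sup>2))
      \<le> recurrence_bound (upper_recurrence_rate (space M) T (I ` {..m}) x)"
proof -
  let ?R = "upper_recurrence_rate (space M) T (I ` {..m}) x"
  let ?a = "\<lambda>n. ereal_of_enat (orbit_AIC U T m I x n)"
  \<comment> \<open>A rate in [0, 1) is finite, so real logarithms apply to it.\<close>
  obtain R where R: "?R = ereal R" "0 \<le> R" "R < 1"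
    using assms(8) upper_recurrence_rate_nonneg[of "space M" T "I ` {..m}" x]
    by (cases ?R) (auto simp: one_ereal_def)
  have T: "T \<in> space M \<rightarrow> space M"
    by (intro Pi_I measurable_space[OF assms(3)])
  have bound: "\<exists>b c. eventually (\<lambda>n. ?a n \<le> ereal ((log 2 (real n))\<^sup>2 / (- log 2 r) + b * log 2 (real n) + c)) sequentially"
    if r: "R < r" "r < 1" for r
  proof -
    have "?R < ereal r" "0 < r" using r R by auto
    then show ?thesis
      using r(2)
    proof (rule orbit_AIC_bound[OF assms(1,2,4,5) T assms(7)])
      fix b c
      assume "\<And>n. 1 \<le> n \<Longrightarrow> ?a n \<le> ereal ((log 2 (real n))\<^sup>2 / (- log 2 r) + b * log 2 (real n) + c)"
      then show ?thesis by (intro exI eventually_sequentiallyI)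
    qed
  qed
  \<comment> \<open>For the comparison with a constant, any single rate between \<open>R\<close> and
    1 is enough.\<close>
  obtain r where "R < r" "r < 1" using R(3) dense by blast
  from bound[OF this] obtain b c where
    "eventually (\<lambda>n. ?a n \<le> ereal ((log 2 (real n))\<^sup>2 / (- log 2 r) + b * log 2 (real n) + c)) sequentially"
    by (elim exE) (rule that)
  from subpoly_equiv_constant[OF eventually_orbit_AIC_ge_1 this]
  have "subpoly_equiv ?a (\<lambda>n. ereal 1)" .
  moreover have "limsup (\<lambda>n. ?a n / ereal ((log 2 (real n))\<^sup>2)) \<le> recurrence_bound (ereal R)"
  \<comment> \<open>The left-hand side does not depend on \<open>r\<close>, so the bound for every
    \<open>r\<close> slightly above \<open>R\<close> passes to the limit.\<close>
  proof (rule tendsto_lowerbound[OF recurrence_bound_tendsto[OF R(2,3)]])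
    show "eventually (\<lambda>r. limsup (\<lambda>n. ?a n / ereal ((log 2 (real n))\<^sup>2)) \<le> ereal (1 / (- log 2 r))) (at_right R)"
      using eventually_at_right_less[of R] eventually_at_right_real[OF R(3)]
    proof eventually_elim
      case (elim r)
      then have "R < r" "r < 1" by simp_all
      from bound[OF this] obtain b c where
        "eventually (\<lambda>n. ?a n \<le> ereal ((log 2 (real n))\<^sup>2 / (- log 2 r) + b * log 2 (real n) + c)) sequentially"
        by (elim exE) (rule that)
      then show ?case by (rule limsup_log_squared_bound)
    qed
  qed simp
  ultimately show ?thesis
    unfolding R(1) by (intro conjI exI[of _ 1]) auto
qed

end
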